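(* The greedoid polynomial of the directed branching greedoid of a (connected) Eulerian digraph is independent of the root vertex. That is, if $G=(V,E)$ is a connected Eulerian digraph and $v_0,v_1\in V$, then $\lambda_{G,v_0}=\lambda_{G,v_1}$.
   Context: Digraphs are finite (multi)graphs; Eulerian means in-degree equals out-degree at every vertex. A tree in $G$ is a subgraph whose underlying undirected graph is connected and cycle-free. An arborescence rooted at $v_0$ is a tree $F$ containing $v_0$ in which every edge $e$ is oriented away from $v_0$ (its tail lies in the component of $F-e$ containing $v_0$). It is spanning if it contains all vertices. The directed branching greedoid of $G$ with root $v_0$ has ground set $E$, its accessible sets are the (edge sets of) arborescences rooted at $v_0$, and its bases are the spanning arborescences rooted at $v_0$. Its dual complex is the abstract simplicial complex $\mathcal{S}$ of all $S\subseteq E$ such that $E\setminus S$ contains a basis; $\dim S=|S|-1$ (so $\dim\emptyset=-1$). For a simplicial complex $\mathcal S$ of dimension $d$, the $h$-polynomial is $h(x)=f(x-1)$ where $f(y)=\sum_{S\in\mathcal{S}}y^{d-\dim S}$. The greedoid polynomial $\lambda_{G,v_0}$ is the $h$-polynomial of the dual complex. *)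

theory Defs
  imports "Graph_Theory.Graph_Theory" "HOL-Computational_Algebra.Polynomial"
begin

hide_const (open) Topological_Spaces.connected

section \<open>Eulerian digraphs\<close>

definition eulerian_digraph :: "('a, 'b) pre_digraph \<Rightarrow> bool" where
  "eulerian_digraph G \<longleftrightarrow> (\<forall>v \<in> verts G. in_degree G v = out_degree G v)"

section \<open>Trees and arborescences\<close>

text \<open>
  The library's \<open>forest\<close> and \<open>tree\<close> only exclude directed cycles, whereas a tree in a digraph must
  not contain a cycle of the underlying undirected multigraph (two parallel or two opposite edges
  form such a cycle, and so does a loop). We make every edge traversable in both directions; an
  undirected cycle is then a cycle that uses no edge twice, the condition \<open>distinct (map fst p)\<close>
  ruling out going along an edge and straight back along the same edge.
\<close>

definition both_orientations :: "('a, 'b) pre_digraph \<Rightarrow> ('a, 'b \<times> bool) pre_digraph" where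
  "both_orientations G =
     \<lparr> verts = verts G,
       arcs = arcs G \<times> UNIV,
       tail = (\<lambda>(e, fwd). if fwd then tail G e else head G e),
       head = (\<lambda>(e, fwd). if fwd then head G e else tail G e) \<rparr>"

definition undirected_cycle :: "('a, 'b) pre_digraph \<Rightarrow> ('b \<times> bool) list \<Rightarrow> bool" where
  "undirected_cycle G p \<longleftrightarrow> pre_digraph.cycle (both_orientations G) p \<and> distinct (map fst p)"

text \<open>
  \<open>Digraph_Component.connected\<close> is connectedness of the underlying undirected graph; it includes
  that the vertex set is nonempty.
\<close>

definition tree_in :: "('a, 'b) pre_digraph \<Rightarrow> ('a, 'b) pre_digraph \<Rightarrow> bool" where
  "tree_in G F \<longleftrightarrow>
     subgraph F G \<and> Digraph_Component.connected F \<and> (\<nexists>p. undirected_cycle F p)"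

definition undirected_component :: "('a, 'b) pre_digraph \<Rightarrow> 'a \<Rightarrow> 'a set" where
  "undirected_component H v = {w. v \<rightarrow>\<^sup>*\<^bsub>with_proj (mk_symmetric H)\<^esub> w}"

definition arborescence :: "('a, 'b) pre_digraph \<Rightarrow> 'a \<Rightarrow> ('a, 'b) pre_digraph \<Rightarrow> bool" where
  "arborescence G v\<^sub>0 F \<longleftrightarrow>
     tree_in G F \<and> v\<^sub>0 \<in> verts F \<and>
     (\<forall>e \<in> arcs F. tail F e \<in> undirected_component (pre_digraph.del_arc F e) v\<^sub>0)"

definition spanning_arborescence ::
    "('a, 'b) pre_digraph \<Rightarrow> 'a \<Rightarrow> ('a, 'b) pre_digraph \<Rightarrow> bool" where
  "spanning_arborescence G v\<^sub>0 F \<longleftrightarrow> arborescence G v\<^sub>0 F \<and> spanning F G"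

section \<open>The directed branching greedoid\<close>

definition branching_greedoid_accessible :: "('a, 'b) pre_digraph \<Rightarrow> 'a \<Rightarrow> 'b set set" where
  "branching_greedoid_accessible G v\<^sub>0 = {arcs F | F. arborescence G v\<^sub>0 F}"

definition branching_greedoid_bases :: "('a, 'b) pre_digraph \<Rightarrow> 'a \<Rightarrow> 'b set set" where
  "branching_greedoid_bases G v\<^sub>0 = {arcs F | F. spanning_arborescence G v\<^sub>0 F}"

lemma branching_greedoid_bases_accessible:
  "branching_greedoid_bases G v\<^sub>0 \<subseteq> branching_greedoid_accessible G v\<^sub>0"
  unfolding branching_greedoid_bases_def branching_greedoid_accessible_def
    spanning_arborescence_def by blast

text \<open>The dual complex of a greedoid depends only on its ground set \<open>E\<close> and its set \<open>\<B>\<close> of bases.\<close>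

definition dual_complex :: "'b set \<Rightarrow> 'b set set \<Rightarrow> 'b set set" where
  "dual_complex E \<B> = {S. S \<subseteq> E \<and> (\<exists>B \<in> \<B>. B \<subseteq> E - S)}"

section \<open>The h-polynomial of a finite simplicial complex\<close>

definition simplex_dim :: "'b set \<Rightarrow> int" where
  "simplex_dim S = int (card S) - 1"

definition complex_dim :: "'b set set \<Rightarrow> int" where
  "complex_dim \<S> = Max (simplex_dim ` \<S>)"

text \<open>In a finite complex every exponent below is nonnegative, so \<open>nat\<close> does not truncate.\<close>

definition f_polynomial :: "'b set set \<Rightarrow> int poly" where
  "f_polynomial \<S> = (\<Sum>S \<in> \<S>. monom 1 (nat (complex_dim \<S> - simplex_dim S)))"

text \<open>Substitution of \<open>x - 1\<close>, represented by \<open>[:- 1, 1:]\<close>.\<close>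

definition h_polynomial :: "'b set set \<Rightarrow> int poly" where
  "h_polynomial \<S> = pcompose (f_polynomial \<S>) [:- 1, 1:]"

definition greedoid_polynomial :: "('a, 'b) pre_digraph \<Rightarrow> 'a \<Rightarrow> int poly" where
  "greedoid_polynomial G v\<^sub>0 =
     h_polynomial (dual_complex (arcs G) (branching_greedoid_bases G v\<^sub>0))"

end

theory Submission
  imports Defs
begin

text \<open>
  A set \<open>S\<close> of arcs lies in the dual complex exactly if the root \<open>v\<close> still reaches every vertex along
  the remaining arcs \<open>A = E - S\<close>: any spanning arborescence witnesses reachability, and conversely a
  breadth-first tree is a spanning arborescence (\<open>contains_basis_iff_reached\<close>). As the greedoid
  polynomial depends only on the number of faces of each size, it is enough that, in an Eulerian
  digraph, the number of \<open>m\<close>-element sets \<open>A\<close> in which \<open>v\<close> reaches everything is the same for all \<open>v\<close>.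
  
  For a fixed \<open>A\<close>, consider flags, i.e. chains of subsets of \<open>V\<close> that contain \<open>v\<close>, with \<open>V\<close> itself as a
  member, and among them those whose members are not left by any arc of \<open>A\<close>. The set reached from \<open>v\<close>
  is the least set containing \<open>v\<close> that \<open>A\<close> does not leave. If it is a proper subset of \<open>V\<close>, inserting
  or deleting it is a sign-reversing involution on these flags; if it is \<open>V\<close>, only the flag \<open>{V}\<close>
  remains. So the sum of \<open>(-1)^|D|\<close> over these flags \<open>D\<close> is \<open>-1\<close> or \<open>0\<close> according to
  whether \<open>v\<close> reaches everything (\<open>sum_closed_flags\<close>). Summing over all \<open>A\<close> of size \<open>m\<close> and exchanging
  the sums, a flag contributes \<open>(-1)^|D|\<close> times the number of \<open>m\<close>-subsets of the arcs that leave no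
  member of \<open>D\<close>, a number that depends only on how many arcs leave some member of \<open>D\<close>.
  
  A flag is the same thing as an ordered partition of \<open>V\<close> into nonempty blocks whose first block
  contains \<open>v\<close>, and the arcs leaving some member are those going from an earlier to a later block.
  Rotating the blocks cyclically until \<open>w\<close> lies in the first one is a bijection between the flags of
  \<open>v\<close> and those of \<open>w\<close>. It moves an initial union \<open>X\<close> of blocks to the end; the forward arcs lose the
  arcs leaving \<open>X\<close> and gain the arcs entering \<open>X\<close>, and in an Eulerian digraph these are equally many
  (\<open>card_exits_eulerian\<close>, \<open>card_flag_exits_rotate\<close>). Hence the two sums agree term by term.
\<close>

section \<open>Reachability as a signed sum over flags\<close>

definition exits :: "('a, 'b) pre_digraph \<Rightarrow> 'a set \<Rightarrow> 'b set" where
  "exits G U = {e \<in> arcs G. tail G e \<in> U \<and> head G e \<notin> U}"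

definition reached :: "('a, 'b) pre_digraph \<Rightarrow> 'b set \<Rightarrow> 'a \<Rightarrow> 'a set" where
  "reached G A v = (arc_to_ends G ` A)\<^sup>* `` {v}"

text \<open>
  The partial unions of the ordered partitions of \<open>V\<close> with \<open>v\<close> in the first block; the whole set \<open>V\<close>
  is kept as the last member, so that the number of members is the number of blocks.
\<close>

definition flags :: "'a set \<Rightarrow> 'a \<Rightarrow> 'a set set set" where
  "flags V v = {D. D \<subseteq> {U. v \<in> U \<and> U \<subseteq> V} \<and> V \<in> D \<and> chain\<^sub>\<subseteq> D}"

definition flag_exits :: "('a, 'b) pre_digraph \<Rightarrow> 'a set set \<Rightarrow> 'b set" where
  "flag_exits G D = (\<Union>U\<in>D. exits G U)"

text \<open>
  In terms of ordered partitions: \<open>X\<close> is the union of the blocks preceding the block of \<open>w\<close>, and these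
  blocks move to the end in unchanged order. The member \<open>X\<close> becomes \<open>V\<close>, and \<open>V\<close> becomes \<open>V - X\<close>.
\<close>

definition rotate_flag :: "'a set \<Rightarrow> 'a \<Rightarrow> 'a set set \<Rightarrow> 'a set set" where
  "rotate_flag V w D =
     (let X = \<Union>{U \<in> D. w \<notin> U} in (\<lambda>U. if w \<in> U then U - X else U \<union> (V - X)) ` D)"

lemma reached_refl: "v \<in> reached G A v"
  by (simp add: reached_def)

lemma reached_step: "e \<in> A \<Longrightarrow> tail G e \<in> reached G A v \<Longrightarrow> head G e \<in> reached G A v"
  unfolding reached_def arc_to_ends_def
  by (force intro: rtrancl_into_rtrancl)

lemma reached_least:
  assumes "v \<in> U" and "\<And>e. e \<in> A \<Longrightarrow> tail G e \<in> U \<Longrightarrow> head G e \<in> U"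
  shows "reached G A v \<subseteq> U"
proof
  fix x assume "x \<in> reached G A v"
  then have "(v, x) \<in> (arc_to_ends G ` A)\<^sup>*" by (simp add: reached_def)
  then show "x \<in> U"
    by induction (use assms in \<open>auto simp: arc_to_ends_def\<close>)
qed

lemma (in wf_digraph) reached_subset_verts:
  "A \<subseteq> arcs G \<Longrightarrow> v \<in> verts G \<Longrightarrow> reached G A v \<subseteq> verts G"
  by (rule reached_least) auto

lemma finite_flags: "finite V \<Longrightarrow> finite (flags V v)"
  by (rule finite_subset[of _ "Pow (Pow V)"]) (auto simp: flags_def)

lemma exits_disjoint_iff:
  "A \<subseteq> arcs G \<Longrightarrow> A \<inter> exits G U = {} \<longleftrightarrow> (\<forall>e\<in>A. tail G e \<in> U \<longrightarrow> head G e \<in> U)"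
  by (auto simp: exits_def)

text \<open>
  The set reached from \<open>v\<close> is contained in every member of the flags considered, so it can be
  inserted into any of them without destroying the chain, and it can be deleted as long as it is not
  the obligatory member \<open>V\<close>.
\<close>

lemma (in fin_digraph) sum_closed_flags:
  fixes A :: "'b set"
  assumes A: "A \<subseteq> arcs G" and v: "v \<in> verts G"
  defines "\<D> \<equiv> {D \<in> flags (verts G) v. A \<inter> flag_exits G D = {}}"
  shows "(\<Sum>D\<in>\<D>. (- 1) ^ card D) = (if reached G A v = verts G then - 1 else (0 :: int))"
proof -
  let ?R = "reached G A v"
  have RV: "?R \<subseteq> verts G" by (rule reached_subset_verts[OF A v])
  have R_le: "?R \<subseteq> U" if "D \<in> \<D>" "U \<in> D" for D U
  proof (rule reached_least)
    show "v \<in> U" using that by (auto simp: \<D>_def flags_def)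
    have "A \<inter> exits G U = {}" using that by (auto simp: \<D>_def flag_exits_def)
    then show "\<And>e. e \<in> A \<Longrightarrow> tail G e \<in> U \<Longrightarrow> head G e \<in> U"
      using exits_disjoint_iff[OF A] by blast
  qed
  have V_exits: "exits G (verts G) = {}" by (auto simp: exits_def)
  have R_exits: "A \<inter> exits G ?R = {}"
    unfolding exits_disjoint_iff[OF A] by (intro ballI impI reached_step)
  show ?thesis
  proof (cases "?R = verts G")
    case True
    have "\<D> = {{verts G}}"
    proof
      show "\<D> \<subseteq> {{verts G}}"
      proof
        fix D assume D: "D \<in> \<D>"
        then have "U = verts G" if "U \<in> D" for U
          using R_le[OF D that] that True by (auto simp: \<D>_def flags_def)
        moreover have "verts G \<in> D" using D by (simp add: \<D>_def flags_def)
        ultimately show "D \<in> {{verts G}}" by blast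
      qed
      have "{verts G} \<in> flags (verts G) v" using v by (simp add: flags_def chain_subset_def)
      moreover have "flag_exits G {verts G} = {}" by (simp add: flag_exits_def V_exits)
      ultimately show "{{verts G}} \<subseteq> \<D>" by (simp add: \<D>_def)
    qed
    then show ?thesis using True by simp
  next
    case False
    \<comment> \<open>The sign-reversing involution.\<close>
    let ?t = "\<lambda>D. if ?R \<in> D then D - {?R} else insert ?R D"
    have tD: "?t D \<in> \<D>" if D: "D \<in> \<D>" for D
    proof (cases "?R \<in> D")
      case True
      then show ?thesis using D False
        by (auto simp: \<D>_def flags_def flag_exits_def chain_subset_def)
    next
      case R: False
      have "chain\<^sub>\<subseteq> (insert ?R D)"
        using D R_le[OF D] by (auto simp: \<D>_def flags_def chain_subset_def)
      moreover have "A \<inter> flag_exits G (insert ?R D) = {}"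
        using D R_exits by (auto simp: \<D>_def flag_exits_def)
      ultimately show ?thesis
        using D R RV reached_refl[of v G A] by (auto simp: \<D>_def flags_def)
    qed
    have fin: "finite D" if "D \<in> \<D>" for D
      using that finite_subset[of D "Pow (verts G)"] by (auto simp: \<D>_def flags_def)
    have sign: "- ((- 1) ^ card (?t D)) = (- 1 :: int) ^ card D" if D: "D \<in> \<D>" for D
    proof (cases "?R \<in> D")
      case True
      obtain n where "card D = Suc n" "card (D - {?R}) = n"
        using True fin[OF D] by (metis card.remove)
      then show ?thesis using True by simp
    next
      case False
      then show ?thesis using fin[OF D] by simp
    qed
    have "(\<Sum>D\<in>\<D>. (- 1 :: int) ^ card D) = (\<Sum>D\<in>\<D>. - ((- 1) ^ card D))"
      by (rule sum.reindex_bij_witness[of _ ?t ?t]) (use tD sign in \<open>auto simp: insert_absorb\<close>)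
    then show ?thesis using False by (simp add: sum_negf)
  qed
qed

section \<open>Rotating a flag\<close>

text \<open>
  Sum the degree condition over \<open>X\<close> and cancel the arcs with both ends in \<open>X\<close>.
\<close>

lemma (in fin_digraph) card_exits_eulerian:
  assumes eul: "eulerian_digraph G" and X: "X \<subseteq> verts G"
  shows "card (exits G (verts G - X)) = card (exits G X)"
proof -
  let ?I = "{e \<in> arcs G. tail G e \<in> X \<and> head G e \<in> X}"
  have fX: "finite X" using X finite_verts finite_subset by blast
  have "card {e \<in> arcs G. head G e \<in> X} = (\<Sum>v\<in>X. in_degree G v)"
  proof -
    have "{e \<in> arcs G. head G e \<in> X} = (\<Union>v\<in>X. in_arcs G v)" by (auto simp: in_arcs_def)
    then show ?thesis unfolding in_degree_def using fX
      by (simp only:) (rule card_UN_disjoint, auto simp: in_arcs_def)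
  qed
  also have "\<dots> = (\<Sum>v\<in>X. out_degree G v)"
    using eul X by (intro sum.cong) (auto simp: eulerian_digraph_def)
  also have "\<dots> = card {e \<in> arcs G. tail G e \<in> X}"
  proof -
    have "{e \<in> arcs G. tail G e \<in> X} = (\<Union>v\<in>X. out_arcs G v)" by (auto simp: out_arcs_def)
    then show ?thesis unfolding out_degree_def using fX
      by (simp only:) (rule card_UN_disjoint[symmetric], auto simp: out_arcs_def)
  qed
  also have "{e \<in> arcs G. tail G e \<in> X} = exits G X \<union> ?I" by (auto simp: exits_def)
  also have "{e \<in> arcs G. head G e \<in> X} = exits G (verts G - X) \<union> ?I"
    by (auto simp: exits_def)
  finally show ?thesis
    by (subst (asm) (1 2) card_Un_disjoint) (auto simp: exits_def)
qed

text \<open>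
  The set removed by a rotation is itself a member of the flag (unless nothing is moved), and it
  separates the members that miss \<open>w\<close> from those that contain \<open>w\<close>.
\<close>

lemma flag_pivot:
  fixes w :: 'a
  assumes D: "D \<in> flags V v" and V: "finite V"
  defines "X \<equiv> \<Union>{U \<in> D. w \<notin> U}"
  shows "w \<notin> X" "X = {} \<or> X \<in> D"
    and "\<And>U. U \<in> D \<Longrightarrow> w \<notin> U \<Longrightarrow> U \<subseteq> X" and "\<And>U. U \<in> D \<Longrightarrow> w \<in> U \<Longrightarrow> X \<subseteq> U"
proof -
  have ch: "chain\<^sub>\<subseteq> D" and sub: "D \<subseteq> Pow V" using D by (auto simp: flags_def)
  have fin: "finite {U \<in> D. w \<notin> U}"
    by (rule finite_subset[of _ "Pow V"]) (use sub V in auto)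
  show "w \<notin> X" by (auto simp: X_def)
  show "\<And>U. U \<in> D \<Longrightarrow> w \<notin> U \<Longrightarrow> U \<subseteq> X" by (auto simp: X_def)
  show "\<And>U. U \<in> D \<Longrightarrow> w \<in> U \<Longrightarrow> X \<subseteq> U"
    using ch by (fastforce simp: X_def chain_subset_def)
  show "X = {} \<or> X \<in> D"
  proof (cases "{U \<in> D. w \<notin> U} = {}")
    case False
    have "X \<in> {U \<in> D. w \<notin> U}"
      unfolding X_def
      by (rule Union_in_chain[OF fin False])
        (use ch in \<open>auto simp: subset.chain_def chain_subset_def\<close>)
    then show ?thesis by simp
  qed (simp only: X_def Union_empty simp_thms)
qed

lemma rotate_flag_id:
  assumes "D \<in> flags V v" and "\<Union>{U \<in> D. w \<notin> U} = {}"
  shows "rotate_flag V w D = D"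
proof -
  have "w \<in> U" if "U \<in> D" for U
    using assms that by (force simp: flags_def)
  then have "rotate_flag V w D = (\<lambda>U. U) ` D"
    unfolding rotate_flag_def Let_def assms(2) by (intro image_cong) auto
  then show ?thesis by simp
qed

lemma rotate_flag_in_flags:
  assumes D: "D \<in> flags V v" and V: "finite V" and w: "w \<in> V"
  shows "rotate_flag V w D \<in> flags V w"
proof -
  define X where "X = \<Union>{U \<in> D. w \<notin> U}"
  note p = flag_pivot[OF D V, where w = w, folded X_def]
  have ch: "chain\<^sub>\<subseteq> D" and sub: "\<And>U. U \<in> D \<Longrightarrow> U \<subseteq> V" and VD: "V \<in> D"
    using D by (auto simp: flags_def)
  let ?r = "\<lambda>U. if w \<in> U then U - X else U \<union> (V - X)"
  have "V \<in> ?r ` D"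
  proof (cases "X = {}")
    case True
    then show ?thesis using VD w by force
  next
    case False
    then have "X \<in> D" using p(2) by simp
    moreover have "V = ?r X" using p(1) sub[OF \<open>X \<in> D\<close>] by auto
    ultimately show ?thesis by (rule rev_image_eqI)
  qed
  moreover have "?r ` D \<subseteq> {U. w \<in> U \<and> U \<subseteq> V}"
    using sub w p(1) by auto
  moreover have "chain\<^sub>\<subseteq> (?r ` D)"
    unfolding chain_subset_def
  proof (intro ballI)
    fix U' W' assume "U' \<in> ?r ` D" "W' \<in> ?r ` D"
    then obtain U W where UW: "U \<in> D" "W \<in> D" and eq: "U' = ?r U" "W' = ?r W" by auto
    have "U \<subseteq> W \<or> W \<subseteq> U" using ch UW by (auto simp: chain_subset_def)
    then show "U' \<subseteq> W' \<or> W' \<subseteq> U'"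
      unfolding eq using sub[OF UW(1)] sub[OF UW(2)] by (cases "w \<in> U"; cases "w \<in> W"; auto)
  qed
  ultimately show ?thesis by (simp add: rotate_flag_def flags_def X_def Let_def)
qed

text \<open>
  The blocks that precede \<open>v\<close> after the rotation make up \<open>V - X\<close>, so rotating back moves exactly these.
\<close>

lemma rotate_flag_inverse:
  assumes D: "D \<in> flags V v" and V: "finite V" and w: "w \<in> V"
  shows "rotate_flag V v (rotate_flag V w D) = D"
proof -
  define X where "X = \<Union>{U \<in> D. w \<notin> U}"
  note p = flag_pivot[OF D V, where w = w, folded X_def]
  have sub: "\<And>U. U \<in> D \<Longrightarrow> U \<subseteq> V" and VD: "V \<in> D" and vU: "\<And>U. U \<in> D \<Longrightarrow> v \<in> U"
    using D by (auto simp: flags_def)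
  show ?thesis
  proof (cases "X = {}")
    case True
    have "\<Union>{U \<in> D. v \<notin> U} = {}" using vU by auto
    then show ?thesis
      using rotate_flag_id[OF D] True D by (simp add: X_def)
  next
    case False
    then have XD: "X \<in> D" using p(2) by simp
    let ?r = "\<lambda>U. if w \<in> U then U - X else U \<union> (V - X)"
    let ?s = "\<lambda>U. if v \<in> U then U - (V - X) else U \<union> (V - (V - X))"
    have rD: "rotate_flag V w D = ?r ` D" by (simp add: rotate_flag_def X_def Let_def)
    have v_r: "v \<in> ?r U \<longleftrightarrow> w \<notin> U" if "U \<in> D" for U
      using vU[OF that] vU[OF XD] by auto
    have "\<Union>{U \<in> ?r ` D. v \<notin> U} = V - X"
    proof
      show "\<Union>{U \<in> ?r ` D. v \<notin> U} \<subseteq> V - X"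
      proof
        fix x assume "x \<in> \<Union>{U \<in> ?r ` D. v \<notin> U}"
        then obtain U where U: "U \<in> D" "x \<in> ?r U" "v \<notin> ?r U" by blast
        then have "w \<in> U" using v_r by blast
        then show "x \<in> V - X" using U(1,2) sub by auto
      qed
      have "V - X \<in> {U \<in> ?r ` D. v \<notin> U}"
        using VD w v_r[OF VD] vU[OF XD] by (auto intro!: rev_image_eqI[OF VD])
      then show "V - X \<subseteq> \<Union>{U \<in> ?r ` D. v \<notin> U}" by blast
    qed
    then have "rotate_flag V v (rotate_flag V w D) = ?s ` ?r ` D"
      unfolding rD by (simp add: rotate_flag_def Let_def)
    also have "\<dots> = D"
    proof -
      have "?s (?r U) = U" if U: "U \<in> D" for U
      proof (cases "w \<in> U")
        case True
        then show ?thesis using v_r[OF U] p(4)[OF U True] sub[OF U] sub[OF XD] vU[OF XD] by auto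
      next
        case False
        then show ?thesis using v_r[OF U] p(3)[OF U False] sub[OF U] sub[OF XD] vU[OF U] by auto
      qed
      then have "(\<lambda>U. ?s (?r U)) ` D = (\<lambda>U. U) ` D" by (intro image_cong refl)
      then show ?thesis unfolding image_image by simp
    qed
    finally show ?thesis .
  qed
qed

text \<open>
  Being an image, the rotated flag is not larger; applied in both directions, this gives equality.
\<close>

lemma card_rotate_flag:
  assumes D: "D \<in> flags V v" and V: "finite V" and w: "w \<in> V" and v: "v \<in> V"
  shows "card (rotate_flag V w D) = card D"
proof -
  have le: "card (rotate_flag V u E) \<le> card E" if "E \<in> flags V x" for u x E
  proof -
    have "finite E" using that V by (auto simp: flags_def intro: finite_subset[of _ "Pow V"])
    then show ?thesis unfolding rotate_flag_def Let_def by (rule card_image_le)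
  qed
  show ?thesis
    using le[OF D, of w] le[OF rotate_flag_in_flags[OF D V w], of v] rotate_flag_inverse[OF D V w]
    by simp
qed

text \<open>
  An arc within \<open>X\<close> or within its complement runs between two blocks whose relative order is
  unchanged. An arc leaving \<open>X\<close> was forward and becomes backward, and an arc entering \<open>X\<close> was backward
  and becomes forward; the Eulerian condition balances the two kinds.
\<close>

lemma (in fin_digraph) card_flag_exits_rotate:
  assumes eul: "eulerian_digraph G" and D: "D \<in> flags (verts G) v" and w: "w \<in> verts G"
  shows "card (flag_exits G (rotate_flag (verts G) w D)) = card (flag_exits G D)"
proof -
  let ?V = "verts G"
  define X where "X = \<Union>{U \<in> D. w \<notin> U}"
  note p = flag_pivot[OF D finite_verts, where w = w, folded X_def]
  have ch: "chain\<^sub>\<subseteq> D" and sub: "\<And>U. U \<in> D \<Longrightarrow> U \<subseteq> ?V" and VD: "?V \<in> D"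
    using D by (auto simp: flags_def)
  show ?thesis
  proof (cases "X = {}")
    case True
    then show ?thesis using rotate_flag_id[OF D] by (simp add: X_def)
  next
    case False
    then have XD: "X \<in> D" using p(2) by simp
    then have XV: "X \<subseteq> ?V" by (rule sub)
    let ?r = "\<lambda>U. if w \<in> U then U - X else U \<union> (?V - X)"
    have rD: "rotate_flag ?V w D = ?r ` D" by (simp add: rotate_flag_def X_def Let_def)
    have cmp: "U \<subseteq> X \<or> X \<subseteq> U" if "U \<in> D" for U using ch XD that by (auto simp: chain_subset_def)
    \<comment> \<open>The forward arcs that do not cross between \<open>X\<close> and its complement.\<close>
    define F where "F = flag_exits G D - exits G X"
    have old: "flag_exits G D = F \<union> exits G X" using XD by (auto simp: F_def flag_exits_def)
    have F_disj: "F \<inter> exits G (?V - X) = {}"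
      using cmp by (fastforce simp: F_def flag_exits_def exits_def)
    have new: "flag_exits G (?r ` D) = F \<union> exits G (?V - X)"
    proof (intro set_eqI)
      fix e
      consider "e \<notin> arcs G" | "e \<in> exits G X" | "e \<in> exits G (?V - X)"
        | (inn) "e \<in> arcs G" "tail G e \<in> X" "head G e \<in> X"
        | (out) "e \<in> arcs G" "tail G e \<in> ?V - X" "head G e \<in> ?V - X"
        using tail_in_verts[of e] head_in_verts[of e]
        by (cases "e \<in> arcs G"; cases "tail G e \<in> X"; cases "head G e \<in> X") (auto simp: exits_def)
      then show "e \<in> flag_exits G (?r ` D) \<longleftrightarrow> e \<in> F \<union> exits G (?V - X)"
      proof cases
        case 1
        then show ?thesis by (auto simp: F_def flag_exits_def exits_def)
      next
        case 2
        then show ?thesis by (auto simp: F_def flag_exits_def exits_def)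
      next
        case 3
        have "e \<in> exits G (?r ?V)" using 3 w by simp
        then have "e \<in> flag_exits G (?r ` D)" using VD unfolding flag_exits_def by blast
        then show ?thesis using 3 by simp
      next
        case inn
        have "e \<in> exits G (?r U) \<longleftrightarrow> e \<in> exits G U" if U: "U \<in> D" for U
          using inn p(4)[OF U] by (auto simp: exits_def)
        then have "e \<in> flag_exits G (?r ` D) \<longleftrightarrow> e \<in> flag_exits G D"
          unfolding flag_exits_def by blast
        moreover have "e \<notin> exits G X" "e \<notin> exits G (?V - X)" using inn by (auto simp: exits_def)
        ultimately show ?thesis by (simp add: F_def)
      next
        case out
        have "e \<in> exits G (?r U) \<longleftrightarrow> e \<in> exits G U" if U: "U \<in> D" for U
          using out p(3)[OF U] by (auto simp: exits_def)
        then have "e \<in> flag_exits G (?r ` D) \<longleftrightarrow> e \<in> flag_exits G D"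
          unfolding flag_exits_def by blast
        moreover have "e \<notin> exits G X" "e \<notin> exits G (?V - X)" using out by (auto simp: exits_def)
        ultimately show ?thesis by (simp add: F_def)
      qed
    qed
    have fin: "finite F" "finite (exits G Y)" for Y
      by (auto simp: F_def flag_exits_def exits_def intro: finite_subset[of _ "arcs G"])
    have "card (flag_exits G (?r ` D)) = card F + card (exits G (?V - X))"
      unfolding new by (rule card_Un_disjoint[OF fin F_disj])
    also have "\<dots> = card F + card (exits G X)" by (simp add: card_exits_eulerian[OF eul XV])
    also have "\<dots> = card (flag_exits G D)"
      unfolding old by (rule card_Un_disjoint[symmetric, OF fin]) (auto simp: F_def)
    finally show ?thesis by (simp add: rD)
  qed
qed

section \<open>Root independence of reachability counts\<close>

lemma sum_card_Pow_cong:
  fixes g :: "nat \<Rightarrow> 'c :: comm_monoid_add"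
  assumes "finite S" "finite T" "card S = card T"
  shows "(\<Sum>A\<in>Pow S. g (card A)) = (\<Sum>A\<in>Pow T. g (card A))"
proof -
  obtain f where f: "bij_betw f S T" using assms finite_same_card_bij by blast
  have "(\<Sum>A\<in>Pow S. g (card A)) = (\<Sum>A\<in>Pow S. g (card (f ` A)))"
    using f by (intro sum.cong refl)
      (metis PowD bij_betw_imp_inj_on card_image inj_on_subset)
  also have "\<dots> = (\<Sum>A\<in>Pow T. g (card A))"
    by (rule sum.reindex_bij_betw[OF bij_betw_Pow[OF f]])
  finally show ?thesis .
qed

text \<open>
  The weight \<open>g\<close> records the sizes of the arc sets; an arbitrary weight serves both to read off which
  sizes occur and to evaluate the polynomial.
\<close>

lemma (in fin_digraph) sum_root_connected_eulerian:
  fixes g :: "nat \<Rightarrow> 'c :: comm_ring_1"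
  assumes eul: "eulerian_digraph G" and v: "v \<in> verts G" and w: "w \<in> verts G"
  shows "(\<Sum>A | A \<subseteq> arcs G \<and> reached G A v = verts G. g (card A))
       = (\<Sum>A | A \<subseteq> arcs G \<and> reached G A w = verts G. g (card A))"
proof -
  define s where "s F = (\<Sum>A\<in>Pow (arcs G - F). g (card A))" for F
  have flag_sum: "(\<Sum>A | A \<subseteq> arcs G \<and> reached G A u = verts G. g (card A))
      = - (\<Sum>D\<in>flags (verts G) u. (- 1) ^ card D * s (flag_exits G D))"
    if u: "u \<in> verts G" for u
  proof -
    let ?FL = "flags (verts G) u"
    have "- (\<Sum>D\<in>?FL. (- 1) ^ card D * s (flag_exits G D))
        = - (\<Sum>D\<in>?FL. \<Sum>A | A \<in> Pow (arcs G) \<and> A \<inter> flag_exits G D = {}. (- 1) ^ card D * g (card A))"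
      unfolding s_def sum_distrib_left
      by (intro arg_cong[of _ _ uminus] sum.cong) auto
    also have "\<dots> = - (\<Sum>A\<in>Pow (arcs G).
        \<Sum>D | D \<in> ?FL \<and> A \<inter> flag_exits G D = {}. (- 1) ^ card D * g (card A))"
      by (subst sum.swap_restrict) (auto simp: finite_flags)
    also have "\<dots> = (\<Sum>A\<in>Pow (arcs G). if reached G A u = verts G then g (card A) else 0)"
    proof (subst sum_negf[symmetric], intro sum.cong refl)
      fix A assume "A \<in> Pow (arcs G)"
      then have A: "A \<subseteq> arcs G" by simp
      have "(\<Sum>D | D \<in> ?FL \<and> A \<inter> flag_exits G D = {}. (- 1) ^ card D * g (card A))
          = of_int (\<Sum>D | D \<in> ?FL \<and> A \<inter> flag_exits G D = {}. (- 1) ^ card D) * g (card A)"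
        by (simp add: sum_distrib_right)
      then show "- (\<Sum>D | D \<in> ?FL \<and> A \<inter> flag_exits G D = {}. (- 1) ^ card D * g (card A))
          = (if reached G A u = verts G then g (card A) else 0)"
        unfolding sum_closed_flags[OF A u] by simp
    qed
    also have "\<dots> = (\<Sum>A | A \<subseteq> arcs G \<and> reached G A u = verts G. g (card A))"
      by (simp add: sum.inter_filter[symmetric])
    finally show ?thesis ..
  qed
  have s_cong: "s F = s F'" if "F \<subseteq> arcs G" "F' \<subseteq> arcs G" "card F = card F'" for F F'
    unfolding s_def
    by (rule sum_card_Pow_cong) (use that in \<open>auto simp: card_Diff_subset finite_subset\<close>)
  have sub: "flag_exits G D \<subseteq> arcs G" for D by (auto simp: flag_exits_def exits_def)
  have "(\<Sum>D\<in>flags (verts G) v. (- 1) ^ card D * s (flag_exits G D))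
      = (\<Sum>D\<in>flags (verts G) w. (- 1) ^ card D * s (flag_exits G D))"
  proof (rule sum.reindex_bij_witness[of _ "rotate_flag (verts G) v" "rotate_flag (verts G) w"])
    fix D assume D: "D \<in> flags (verts G) v"
    show "(- 1) ^ card (rotate_flag (verts G) w D) * s (flag_exits G (rotate_flag (verts G) w D))
        = (- 1) ^ card D * s (flag_exits G D)"
      using s_cong[OF sub sub card_flag_exits_rotate[OF eul D w]]
      by (simp add: card_rotate_flag[OF D finite_verts w v])
  qed (simp_all add: rotate_flag_inverse[OF _ finite_verts] rotate_flag_in_flags[OF _ finite_verts] v w)
  then show ?thesis by (simp add: flag_sum v w)
qed

section \<open>Spanning arborescences and reachability\<close>

lemma both_orientations_simps [simp]:
  "verts (both_orientations H) = verts H"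
  "arcs (both_orientations H) = arcs H \<times> UNIV"
  "tail (both_orientations H) a = (if snd a then tail H (fst a) else head H (fst a))"
  "head (both_orientations H) a = (if snd a then head H (fst a) else tail H (fst a))"
  by (auto simp: both_orientations_def split: prod.splits)

lemma (in wf_digraph) wf_both_orientations: "wf_digraph (both_orientations G)"
  by unfold_locales auto

lemma arcs_ends_both_orientations:
  "arcs_ends (both_orientations H) = arcs_ends (with_proj (mk_symmetric H))"
  by (auto simp: arcs_ends_def arc_to_ends_def parcs_mk_symmetric image_iff
      with_proj_def; metis (full_types) fst_conv snd_conv)

text \<open>
  Reachability in the symmetrised simple digraph forgets which arc is used. Replacing it by
  reachability in the digraph of both orientations gives paths from which undirected cycles can be
  built.
\<close>

lemma undirected_component_conv:
  "undirected_component H v = {w. v \<rightarrow>\<^sup>*\<^bsub>both_orientations H\<^esub> w}"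
  by (simp add: undirected_component_def reachable_def arcs_ends_both_orientations)

lemma undirected_reachable_sym:
  "u \<rightarrow>\<^sup>*\<^bsub>both_orientations H\<^esub> w \<Longrightarrow> w \<rightarrow>\<^sup>*\<^bsub>both_orientations H\<^esub> u"
  using symmetric_reachable[OF symmetric_mk_symmetric[of H]]
  by (simp add: reachable_def arcs_ends_both_orientations)

text \<open>
  Traversing the same edge again, in either direction, would return to the vertex at which it was
  first entered.
\<close>

lemma (in wf_digraph) apath_both_orientations_distinct:
  assumes "pre_digraph.apath (both_orientations G) u p w"
  shows "distinct (map fst p)"
proof -
  interpret B: wf_digraph "both_orientations G" by (rule wf_both_orientations)
  show ?thesis using assms
  proof (induction p arbitrary: u)
    case (Cons a p)
    have path: "B.apath (head (both_orientations G) a) p w"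
      and new: "tail (both_orientations G) a \<notin> set (B.awalk_verts (head (both_orientations G) a) p)"
      using Cons.prems unfolding B.apath_Cons_iff by blast+
    have "fst b \<noteq> fst a" if b: "b \<in> set p" for b
      using new B.awalk_verts_arc1[OF b] B.awalk_verts_arc2[OF B.awalkI_apath[OF path] b]
      by (auto split: if_splits)
    then show ?case using Cons.IH[OF path] by force
  qed simp
qed

text \<open>
  If not every vertex were reached, connectedness would give an edge whose head \<open>x\<close> is reached by a
  directed path but whose tail \<open>y\<close> is not. That directed path avoids the edge, and by the orientation
  condition so does some undirected path from the root to \<open>y\<close>; together they join \<open>x\<close> to \<open>y\<close> without
  the edge, which therefore closes an undirected cycle.
\<close>

lemma arborescence_reached:
  assumes arb: "arborescence G v F"
  shows "reached F (arcs F) v = verts F"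
proof
  have tree: "tree_in G F" and vF: "v \<in> verts F"
    and tails: "\<And>e. e \<in> arcs F \<Longrightarrow> tail F e \<in> undirected_component (pre_digraph.del_arc F e) v"
    using arb by (auto simp: arborescence_def)
  then have acyc: "\<nexists>p. undirected_cycle F p" and conn: "Digraph_Component.connected F"
    and "wf_digraph F"
    by (auto simp: tree_in_def subgraph_def)
  interpret F: wf_digraph F by fact
  interpret B: wf_digraph "both_orientations F" by (rule F.wf_both_orientations)
  let ?R = "reached F (arcs F) v"
  show "?R \<subseteq> verts F" by (rule F.reached_subset_verts[OF order_refl vF])
  have "y \<in> ?R" if "v \<rightarrow>\<^sup>*\<^bsub>both_orientations F\<^esub> y" for y
    using that
  proof (induction rule: B.reachable_induct)
    case base
    show ?case by (rule reached_refl)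
  next
    case (step x y)
    then obtain a where a: "fst a \<in> arcs F" "tail (both_orientations F) a = x" "head (both_orientations F) a = y"
      by (auto simp: arcs_ends_def arc_to_ends_def)
    define e where "e = fst a"
    show ?case
    proof (rule ccontr)
      assume y: "y \<notin> ?R"
      have e: "e \<in> arcs F" "tail F e = y" "head F e = x"
        using a y reached_step[of e "arcs F" F v] step.IH by (auto simp: e_def split: if_splits)
      let ?F' = "F.del_arc e"
      interpret F': wf_digraph ?F' by (rule F.wf_digraph_del_arc)
      interpret B': wf_digraph "both_orientations ?F'" by (rule F'.wf_both_orientations)
      \<comment> \<open>The tail of \<open>e\<close> is not reached, so directed paths from the root never use \<open>e\<close>.\<close>
      have "?R \<subseteq> {z \<in> ?R. v \<rightarrow>\<^sup>*\<^bsub>both_orientations ?F'\<^esub> z}"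
      proof (rule reached_least)
        show "v \<in> {z \<in> ?R. v \<rightarrow>\<^sup>*\<^bsub>both_orientations ?F'\<^esub> z}"
          using vF by (auto simp: reached_refl F.verts_del_arc)
        fix f assume f: "f \<in> arcs F" and t: "tail F f \<in> {z \<in> ?R. v \<rightarrow>\<^sup>*\<^bsub>both_orientations ?F'\<^esub> z}"
        then have "f \<noteq> e" using e y by auto
        then have "tail F f \<rightarrow>\<^bsub>both_orientations ?F'\<^esub> head F f"
          using f by (auto simp: arcs_ends_def arc_to_ends_def F.arcs_del_arc F.head_del_arc F.tail_del_arc
              intro!: image_eqI[of _ _ "(f, True)"])
        then show "head F f \<in> {z \<in> ?R. v \<rightarrow>\<^sup>*\<^bsub>both_orientations ?F'\<^esub> z}"
          using t f reached_step[of f "arcs F" F v] by (auto intro: B'.reachable_adj_trans)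
      qed
      then have "x \<rightarrow>\<^sup>*\<^bsub>both_orientations ?F'\<^esub> v"
        using step.IH by (blast intro: undirected_reachable_sym)
      moreover have "v \<rightarrow>\<^sup>*\<^bsub>both_orientations ?F'\<^esub> y"
        using tails[OF e(1)] e(2) by (simp add: undirected_component_conv)
      ultimately have "x \<rightarrow>\<^sup>*\<^bsub>both_orientations ?F'\<^esub> y" by (rule B'.reachable_trans)
      then obtain p where p: "B'.apath x p y" by (auto simp: B'.reachable_apath)
      have edges: "fst ` set p \<subseteq> arcs F - {e}"
        using B'.awalkI_apath[OF p] by (auto simp: B'.awalk_def F.arcs_del_arc)
      have sub: "subgraph (both_orientations ?F') (both_orientations F)"
        by (rule subgraphI)
          (auto simp: compatible_def fun_eq_iff F.arcs_del_arc F.verts_del_arc F.head_del_arc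
            F.tail_del_arc B'.wf_digraph_axioms B.wf_digraph_axioms)
      have "B.apath x p y" by (rule B.subgraph_apath_imp_apath[OF p sub])
      then have "B.cycle ((e, True) # p)"
        unfolding B.cycle_def using e by (auto simp: B.apath_def B.awalk_Cons_iff)
      moreover have "distinct (map fst ((e, True) # p))"
        using F'.apath_both_orientations_distinct[OF p] edges by auto
      ultimately show False using acyc by (auto simp: undirected_cycle_def)
    qed
  qed
  moreover have "v \<rightarrow>\<^sup>*\<^bsub>both_orientations F\<^esub> y" if "y \<in> verts F" for y
    using conn vF that
    by (auto simp: Digraph_Component.connected_def strongly_connected_def reachable_def
        arcs_ends_both_orientations)
  ultimately show "verts F \<subseteq> ?R" by blast
qed

section \<open>Breadth-first trees\<close>

text \<open>
  A parent arc into each non-root vertex, coming from the previous level. The levels are the distances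
  from the root when they arise from breadth-first search, but the only property of distances that
  the proofs use is that they drop by one along parent arcs.
\<close>

definition bfs_parents :: "('a, 'b) pre_digraph \<Rightarrow> 'a \<Rightarrow> ('a \<Rightarrow> nat) \<Rightarrow> ('a \<Rightarrow> 'b) \<Rightarrow> bool" where
  "bfs_parents G v d par \<longleftrightarrow> (\<forall>y \<in> verts G - {v}.
     par y \<in> arcs G \<and> head G (par y) = y \<and> d y = Suc (d (tail G (par y))))"

lemma bfs_parents_exist:
  assumes A: "A \<subseteq> arcs G" and reach: "verts G \<subseteq> reached G A v"
  obtains d par where "bfs_parents G v d par" "par ` (verts G - {v}) \<subseteq> A"
proof -
  define r where "r = arc_to_ends G ` A"
  define d where "d y = (LEAST n. (v, y) \<in> r ^^ n)" for y
  have "\<exists>e\<in>A. head G e = y \<and> d y = Suc (d (tail G e))" if y: "y \<in> verts G - {v}" for y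
  proof -
    have "(v, y) \<in> r\<^sup>*" using y reach by (auto simp: reached_def r_def)
    then obtain n where "(v, y) \<in> r ^^ n" by (auto simp: rtrancl_power)
    then have dy: "(v, y) \<in> r ^^ d y" unfolding d_def by (rule LeastI)
    with y obtain m where m: "d y = Suc m" by (cases "d y") auto
    then obtain z where z: "(v, z) \<in> r ^^ m" "(z, y) \<in> r" using dy by auto
    then obtain e where e: "e \<in> A" "tail G e = z" "head G e = y"
      by (auto simp: r_def arc_to_ends_def)
    have "d z \<le> m" unfolding d_def by (rule Least_le) (rule z)
    moreover have "d y \<le> Suc (d z)"
    proof -
      have "(v, z) \<in> r ^^ d z" unfolding d_def by (rule LeastI) (rule z)
      then have "(v, y) \<in> r ^^ Suc (d z)" using z(2) by auto
      then show ?thesis unfolding d_def by (rule Least_le)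
    qed
    ultimately have "d y = Suc (d z)" using m by simp
    with e show ?thesis by auto
  qed
  then obtain par where "\<And>y. y \<in> verts G - {v} \<Longrightarrow>
      par y \<in> A \<and> head G (par y) = y \<and> d y = Suc (d (tail G (par y)))" by metis
  then show thesis using that[of d par] A by (auto simp: bfs_parents_def)
qed

definition bfs_tree :: "('a, 'b) pre_digraph \<Rightarrow> 'a \<Rightarrow> ('a \<Rightarrow> 'b) \<Rightarrow> ('a, 'b) pre_digraph" where
  "bfs_tree G v par = G\<lparr> arcs := par ` (verts G - {v}) \<rparr>"

lemma bfs_tree_simps [simp]:
  "verts (bfs_tree G v par) = verts G" "arcs (bfs_tree G v par) = par ` (verts G - {v})"
  "tail (bfs_tree G v par) = tail G" "head (bfs_tree G v par) = head G"
  by (simp_all add: bfs_tree_def)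

lemma bfs_tree_arcD:
  assumes "bfs_parents G v d par" and "e \<in> arcs (bfs_tree G v par)"
  shows "e \<in> arcs G" "par (head G e) = e" "d (head G e) = Suc (d (tail G e))"
proof -
  obtain y where "y \<in> verts G - {v}" "e = par y" using assms(2) by auto
  then show "e \<in> arcs G" "par (head G e) = e" "d (head G e) = Suc (d (tail G e))"
    using assms(1) unfolding bfs_parents_def by metis+
qed

context wf_digraph
begin

lemma wf_bfs_tree:
  "bfs_parents G v d par \<Longrightarrow> wf_digraph (bfs_tree G v par)"
  by unfold_locales (use bfs_tree_arcD(1) in fastforce)+

text \<open>
  Following parent arcs from \<open>y\<close> only visits vertices of level at most \<open>d y\<close>. Stating it for any
  digraph \<open>H\<close> that keeps their parent arcs covers both the whole tree and the tree with one arc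
  deleted, which cuts off only vertices of larger level.
\<close>

lemma bfs_reachable:
  assumes par: "bfs_parents G v d par" and v: "v \<in> verts G"
    and H: "wf_digraph H" "verts H = verts G" "tail H = tail G" "head H = head G"
    and y: "y \<in> verts G"
    and keep: "\<And>x. x \<in> verts G - {v} \<Longrightarrow> d x \<le> d y \<Longrightarrow> par x \<in> arcs H"
  shows "v \<rightarrow>\<^sup>*\<^bsub>H\<^esub> y"
  using y keep
proof (induction "d y" arbitrary: y rule: less_induct)
  case less
  interpret H: wf_digraph H by fact
  show ?case
  proof (cases "y = v")
    case True
    then show ?thesis using v H by auto
  next
    case False
    then have y: "y \<in> verts G - {v}" using less.prems by simp
    let ?x = "tail G (par y)"
    have p: "par y \<in> arcs G" "head G (par y) = y" "d y = Suc (d ?x)"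
      using par y by (auto simp: bfs_parents_def)
    have "v \<rightarrow>\<^sup>*\<^bsub>H\<^esub> ?x"
      by (rule less.hyps) (use p less.prems in auto)
    moreover have "?x \<rightarrow>\<^bsub>H\<^esub> y"
      using H.in_arcs_imp_in_arcs_ends[of "par y"] less.prems(2)[OF y] p(2) H by simp
    ultimately show ?thesis by (rule H.reachable_adj_trans)
  qed
qed

text \<open>
  A trail that has gone down to \<open>y\<close> has used the parent arc of \<open>y\<close>, the only arc into \<open>y\<close>, and must
  go on downwards. So a trail first climbs and then descends, and it is purely descending if its
  first step is, and purely climbing if its last step is.
\<close>

lemma bfs_tree_trail_levels:
  assumes par: "bfs_parents G v d par"
    and "pre_digraph.awalk (both_orientations (bfs_tree G v par)) u p w"
    and "distinct (map fst p)" and "p \<noteq> []"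
  shows "(snd (hd p) \<longrightarrow> d u < d w) \<and> (\<not> snd (last p) \<longrightarrow> d w < d u)"
proof -
  let ?F = "bfs_tree G v par"
  interpret F: wf_digraph ?F by (rule wf_bfs_tree[OF par])
  interpret B: wf_digraph "both_orientations ?F" by (rule F.wf_both_orientations)
  have level: "d (head G e) = Suc (d (tail G e))" and unique: "par (head G e) = e"
    if "e \<in> arcs ?F" for e using bfs_tree_arcD[OF par that] by simp_all
  show ?thesis using assms(2-)
  proof (induction p arbitrary: u)
    case (Cons a p)
    let ?u' = "head (both_orientations ?F) a"
    have a: "fst a \<in> arcs ?F" "u = tail (both_orientations ?F) a" and walk: "B.awalk ?u' p w"
      using Cons.prems(1) by (auto simp: B.awalk_Cons_iff)
    have du: "if snd a then d ?u' = Suc (d u) else d u = Suc (d ?u')"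
      using level[OF a(1)] a(2) by simp
    show ?case
    proof (cases p)
      case Nil
      then show ?thesis using du walk by (auto simp: B.awalk_Nil_iff split: if_splits)
    next
      case (Cons b q)
      have b: "fst b \<in> arcs ?F" "?u' = tail (both_orientations ?F) b"
        using walk Cons by (auto simp: B.awalk_Cons_iff)
      have "fst b \<noteq> fst a" using Cons.prems(2) Cons by auto
      then have fwd: "snd b" if "snd a"
        using that a b unique[OF a(1)] unique[OF b(1)] by (auto split: if_splits)
      have IH: "(snd b \<longrightarrow> d ?u' < d w) \<and> (\<not> snd (last p) \<longrightarrow> d w < d ?u')"
        using Cons.IH[OF walk] Cons.prems(2) Cons by simp
      show ?thesis using IH fwd du Cons by (cases "snd a") auto
    qed
  qed simp
qed

text \<open>
  By the shape of trails, an undirected cycle would start with a climb from a vertex \<open>u\<close> and end with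
  a descent to \<open>u\<close>. Both steps use the parent arc of \<open>u\<close>.
\<close>

lemma bfs_tree_acyclic:
  assumes par: "bfs_parents G v d par"
  shows "\<not> undirected_cycle (bfs_tree G v par) p"
proof
  let ?F = "bfs_tree G v par"
  interpret F: wf_digraph ?F by (rule wf_bfs_tree[OF par])
  interpret B: wf_digraph "both_orientations ?F" by (rule F.wf_both_orientations)
  assume "undirected_cycle ?F p"
  then obtain u where walk: "B.awalk u p u" and dist: "distinct (map fst p)" and ne: "p \<noteq> []"
    by (auto simp: undirected_cycle_def B.cycle_def)
  have ends: "\<not> snd (hd p)" "snd (last p)"
    using bfs_tree_trail_levels[OF par walk dist ne] by auto
  have cas: "B.cas u p u" and arcs: "set p \<subseteq> arcs (both_orientations ?F)"
    using walk by (auto simp: B.awalk_def)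
  have "head G (fst (hd p)) = u"
    using cas ends(1) ne by (cases p) auto
  moreover have "head G (fst (last p)) = u"
    using B.awlast_if_cas[OF cas] ends(2) ne by (simp add: B.awalk_verts_conv)
  moreover have "par (head G e) = e" if "e \<in> arcs ?F" for e
    using bfs_tree_arcD(2)[OF par that] .
  moreover have "fst (hd p) \<in> arcs ?F" "fst (last p) \<in> arcs ?F"
    using arcs hd_in_set[OF ne] last_in_set[OF ne]
    by (metis both_orientations_simps(2) mem_Times_iff subsetD)+
  ultimately have eq: "fst (hd p) = fst (last p)" by metis
  show False
  proof (cases p)
    case (Cons a q)
    then show ?thesis using eq dist ends last_in_set[of q] by (cases "q = []") auto
  qed (use ne in simp)
qed

lemma bfs_tree_spanning_arborescence:
  assumes par: "bfs_parents G v d par" and v: "v \<in> verts G"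
  shows "spanning_arborescence G v (bfs_tree G v par)"
proof -
  let ?F = "bfs_tree G v par"
  interpret F: wf_digraph ?F by (rule wf_bfs_tree[OF par])
  interpret B: wf_digraph "both_orientations ?F" by (rule F.wf_both_orientations)
  have und: "v \<rightarrow>\<^sup>*\<^bsub>both_orientations H\<^esub> y" if "wf_digraph H" "v \<rightarrow>\<^sup>*\<^bsub>H\<^esub> y" for H :: "('a, 'b) pre_digraph" and y
    using wf_digraph.reachable_mk_symmetricI[OF that]
    by (simp add: reachable_def arcs_ends_both_orientations)
  have reach: "v \<rightarrow>\<^sup>*\<^bsub>both_orientations ?F\<^esub> y" if "y \<in> verts G" for y
    by (rule und[OF F.wf_digraph_axioms], rule bfs_reachable[OF par v F.wf_digraph_axioms])
      (use that in auto)
  have "x \<rightarrow>\<^sup>*\<^bsub>both_orientations ?F\<^esub> y" if "x \<in> verts G" "y \<in> verts G" for x y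
    using undirected_reachable_sym[OF reach[OF that(1)]] reach[OF that(2)] by (rule B.reachable_trans)
  then have conn: "Digraph_Component.connected ?F"
    using v by (auto simp: Digraph_Component.connected_def strongly_connected_def reachable_def
        arcs_ends_both_orientations)
  have sub: "subgraph ?F G"
    using par by (intro subgraphI) (auto simp: bfs_parents_def compatible_def F.wf_digraph_axioms wf_digraph_axioms)
  have tails: "tail ?F e \<in> undirected_component (pre_digraph.del_arc ?F e) v" if e: "e \<in> arcs ?F" for e
  proof -
    have lt: "d (tail G e) < d (head G e)" and eG: "e \<in> arcs G"
      using bfs_tree_arcD[OF par e] by simp_all
    have wf: "wf_digraph (F.del_arc e)" by (rule F.wf_digraph_del_arc)
    have "v \<rightarrow>\<^sup>*\<^bsub>F.del_arc e\<^esub> tail G e"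
    proof (rule bfs_reachable[OF par v wf])
      fix x assume x: "x \<in> verts G - {v}" "d x \<le> d (tail G e)"
      then have "par x \<noteq> e" using par lt by (auto simp: bfs_parents_def)
      then show "par x \<in> arcs (F.del_arc e)" using x by (simp add: F.arcs_del_arc)
    qed (use eG in \<open>auto simp: F.verts_del_arc F.tail_del_arc F.head_del_arc\<close>)
    from und[OF wf this] show ?thesis by (simp add: undirected_component_conv)
  qed
  show ?thesis
    using sub conn bfs_tree_acyclic[OF par] v tails
    by (auto simp: spanning_arborescence_def arborescence_def tree_in_def spanning_def)
qed

lemma contains_basis_iff_reached:
  assumes A: "A \<subseteq> arcs G" and v: "v \<in> verts G"
  shows "(\<exists>B\<in>branching_greedoid_bases G v. B \<subseteq> A) \<longleftrightarrow> reached G A v = verts G"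
proof
  assume "\<exists>B\<in>branching_greedoid_bases G v. B \<subseteq> A"
  then obtain F where F: "spanning_arborescence G v F" "arcs F \<subseteq> A"
    by (auto simp: branching_greedoid_bases_def)
  then have "reached F (arcs F) v = verts G" and "tail F = tail G" "head F = head G"
    using arborescence_reached[of G v F]
    by (auto simp: spanning_arborescence_def spanning_def subgraph_def compatible_def)
  moreover have "reached F (arcs F) v \<subseteq> reached G A v"
    using F(2) calculation(2,3) reached_step[of _ A G v]
    by (intro reached_least) (auto simp: reached_refl)
  ultimately show "reached G A v = verts G" using reached_subset_verts[OF A v] by auto
next
  assume "reached G A v = verts G"
  then obtain d par where "bfs_parents G v d par" "par ` (verts G - {v}) \<subseteq> A"
    using bfs_parents_exist[OF A, of v] by auto
  then show "\<exists>B\<in>branching_greedoid_bases G v. B \<subseteq> A"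
    using bfs_tree_spanning_arborescence[OF _ v, of d par]
    by (force simp: branching_greedoid_bases_def)
qed

end

section \<open>Face numbers of the dual complex\<close>

lemma (in fin_digraph) sum_dual_complex_root_independent:
  fixes g :: "nat \<Rightarrow> 'c :: comm_ring_1"
  assumes eul: "eulerian_digraph G" and v: "v \<in> verts G" and w: "w \<in> verts G"
  shows "(\<Sum>S\<in>dual_complex (arcs G) (branching_greedoid_bases G v). g (card S))
       = (\<Sum>S\<in>dual_complex (arcs G) (branching_greedoid_bases G w). g (card S))"
proof -
  let ?E = "arcs G"
  have "(\<Sum>S\<in>dual_complex ?E (branching_greedoid_bases G u). g (card S))
      = (\<Sum>A | A \<subseteq> ?E \<and> reached G A u = verts G. g (card ?E - card A))"
    if u: "u \<in> verts G" for u
  proof (rule sum.reindex_bij_witness[of _ "\<lambda>A. ?E - A" "\<lambda>S. ?E - S"])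
    show "?E - S \<in> {A. A \<subseteq> ?E \<and> reached G A u = verts G}"
      if "S \<in> dual_complex ?E (branching_greedoid_bases G u)" for S
      using that contains_basis_iff_reached[OF Diff_subset u, of S] by (auto simp: dual_complex_def)
    show "?E - A \<in> dual_complex ?E (branching_greedoid_bases G u)"
      if "A \<in> {A. A \<subseteq> ?E \<and> reached G A u = verts G}" for A
      using that contains_basis_iff_reached[of A u] u by (auto simp: dual_complex_def double_diff)
    show "g (card ?E - card (?E - S)) = g (card S)"
      if "S \<in> dual_complex ?E (branching_greedoid_bases G u)" for S
    proof -
      have "S \<subseteq> ?E" using that by (simp add: dual_complex_def)
      then have "card S \<le> card ?E" "card (?E - S) = card ?E - card S"
        by (simp_all add: card_mono card_Diff_subset finite_subset)
      then show ?thesis by simp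
    qed
  qed (auto simp: dual_complex_def)
  then show ?thesis
    using sum_root_connected_eulerian[OF eul v w, of "\<lambda>k. g (card ?E - k)"] v w by simp
qed

lemma card_image_eq_if_sums_eq:
  fixes \<S> \<T> :: "'a set set"
  assumes fin: "finite \<S>" "finite \<T>"
    and sums: "\<And>g :: nat \<Rightarrow> int. (\<Sum>S\<in>\<S>. g (card S)) = (\<Sum>S\<in>\<T>. g (card S))"
  shows "card ` \<S> = card ` \<T>"
proof -
  have occurs: "k \<in> card ` \<U> \<longleftrightarrow> (\<Sum>S\<in>\<U>. if card S = k then 1 else 0) \<noteq> (0 :: int)"
    if "finite \<U>" for k and \<U> :: "'a set set"
    using that by (auto simp: sum_nonneg_eq_0_iff)
  show ?thesis
    by (rule set_eqI)
      (simp only: occurs[OF fin(1)] occurs[OF fin(2)] sums[of "\<lambda>c. if c = _ then 1 else 0"])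
qed

text \<open>
  The dimension of the complex enters the exponents of the \<open>f\<close>-polynomial, so it has to be shown
  root-independent before the weighted sums over faces can be compared.
\<close>

theorem corollary4p8:
  fixes G :: "('a, 'b) pre_digraph" and v\<^sub>0 v\<^sub>1 :: 'a
  assumes "fin_digraph G"
    and "Digraph_Component.connected G"
    and "eulerian_digraph G"
    and "v\<^sub>0 \<in> verts G" and "v\<^sub>1 \<in> verts G"
  shows "greedoid_polynomial G v\<^sub>0 = greedoid_polynomial G v\<^sub>1"
proof -
  interpret fin_digraph G by fact
  let ?S = "\<lambda>v. dual_complex (arcs G) (branching_greedoid_bases G v)"
  have fin: "finite (?S v)" for v
    by (rule finite_subset[of _ "Pow (arcs G)"]) (auto simp: dual_complex_def)
  have "card ` ?S v\<^sub>0 = card ` ?S v\<^sub>1"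
    by (rule card_image_eq_if_sums_eq[OF fin fin])
      (rule sum_dual_complex_root_independent[OF assms(3-5)])
  then have "simplex_dim ` ?S v\<^sub>0 = simplex_dim ` ?S v\<^sub>1"
    unfolding simplex_dim_def image_image[of "\<lambda>n. int n - 1" card, symmetric] by simp
  then have dim: "complex_dim (?S v\<^sub>0) = complex_dim (?S v\<^sub>1)" by (simp add: complex_dim_def)
  have "f_polynomial (?S v\<^sub>0) = f_polynomial (?S v\<^sub>1)"
    unfolding f_polynomial_def dim simplex_dim_def
    by (rule sum_dual_complex_root_independent[OF assms(3-5)])
  then show ?thesis by (simp add: greedoid_polynomial_def h_polynomial_def)
qed

end
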